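(* Let $G\in\mathbf{RH}_\infty$ and let $\beta\ge 2$ be an integer. Let $\omega_r=\frac{r}{\beta}\pi$ for $r=1,2,\dots,\beta-1$. For $i=0,1,\dots,2\beta-1$ define the vectors $\mathbf{v}_i^-,\mathbf{v}_i^+\in\mathbb{R}^{\beta-1}$ by $$(\mathbf{v}_i^{-})_r=\mathrm{Re}\{(1-e^{-j\omega_ri})G(e^{j\omega_r})\},\qquad(\mathbf{v}_i^{+})_r=\mathrm{Re}\{(1+e^{-j\omega_ri})G(e^{j\omega_r})\},\qquad r=1,\dots,\beta-1.$$ (i) If there exists a nonzero $\Lambda=(\lambda_1,\dots,\lambda_{\beta-1})^\top\in\mathbb{R}^{\beta-1}$ with all entries non-negative such that $\Lambda^\top\mathbf{v}_i^-\le 0$ for all $i=0,1,\dots,2\beta-1$, then there is no $M\in\mathcal{M}$ such that $\mathrm{Re}\{M(e^{j\omega})G(e^{j\omega})\}>0$ for all $\omega\in[0,\pi]$. (ii) If there exists a nonzero $\Lambda\in\mathbb{R}^{\beta-1}$ with all entries non-negative such that $\Lambda^\top\mathbf{v}_i^-\le 0$ and $\Lambda^\top\mathbf{v}_i^+\le 0$ for all $i=0,1,\dots,2\beta-1$, then there is no $M\in\mathcal{M}_{\text{odd}}$ such that $\mathrm{Re}\{M(e^{j\omega})G(e^{j\omega})\}>0$ for all $\omega\in[0,\pi]$.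
   Context: $j$ is the imaginary unit. $\mathbf{RH}_\infty$ is the set of scalar proper rational functions $G(z)$ with real coefficients all of whose poles lie in the open unit disk (stable plants). For a real two-sided sequence $h=(h_i)_{i\in\mathbb{Z}}$, $\|h\|_1=\sum_{i\in\mathbb{Z}}|h_i|$. Discrete-time LTI Zames-Falb multipliers: $\mathcal{M}$ is the set of functions on the unit circle of the form $M(e^{j\omega})=1-H(e^{j\omega})$, $H(e^{j\omega})=\sum_{i\in\mathbb{Z}}h_ie^{-j\omega i}$, where $h$ is a real sequence with $h_0=0$, $h_i\ge 0$ for all $i$ and $\|h\|_1\le 1$. $\mathcal{M}_{\text{odd}}$ is the set of such functions where $h$ is a real sequence with $h_0=0$ and $\|h\|_1\le 1$ (no sign condition). *)

theory Defs
  imports "HOL-Analysis.Analysis" "HOL-Computational_Algebra.Computational_Algebra"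
begin

text \<open>
  A rational function is represented by its evaluation map. As \<open>p\<close> and \<open>q\<close> are coprime,
  the poles are exactly the complex roots of \<open>q\<close>.
\<close>

definition RH_inf :: "(complex \<Rightarrow> complex) set" where
  "RH_inf = {G. \<exists>p q :: real poly. q \<noteq> 0 \<and> coprime p q \<and> degree p \<le> degree q \<and>
     (\<forall>z. poly (map_poly complex_of_real q) z = 0 \<longrightarrow> norm z < 1) \<and>
     G = (\<lambda>z. poly (map_poly complex_of_real p) z / poly (map_poly complex_of_real q) z)}"

definition l1_norm :: "(int \<Rightarrow> real) \<Rightarrow> real" where
  "l1_norm h = (\<Sum>\<^sub>\<infinity>i\<in>UNIV. \<bar>h i\<bar>)"

definition fourier_symbol :: "(int \<Rightarrow> real) \<Rightarrow> real \<Rightarrow> complex" where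
  "fourier_symbol h \<omega> = (\<Sum>\<^sub>\<infinity>i\<in>UNIV. complex_of_real (h i) * cis (- (\<omega> * real_of_int i)))"

text \<open>
  A multiplier is a function on the unit circle, so only its values at the points
  \<open>cis \<omega>\<close> are constrained. Summability is required explicitly because \<open>infsum\<close>
  is \<open>0\<close> on non-summable families.
\<close>

definition ZF_odd :: "(complex \<Rightarrow> complex) set" where
  "ZF_odd = {M. \<exists>h :: int \<Rightarrow> real. h 0 = 0 \<and>
     (\<lambda>i. \<bar>h i\<bar>) summable_on UNIV \<and> l1_norm h \<le> 1 \<and>
     (\<forall>\<omega>. M (cis \<omega>) = 1 - fourier_symbol h \<omega>)}"

definition ZF :: "(complex \<Rightarrow> complex) set" where
  "ZF = {M. \<exists>h :: int \<Rightarrow> real. h 0 = 0 \<and> (\<forall>i. 0 \<le> h i) \<and>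
     (\<lambda>i. \<bar>h i\<bar>) summable_on UNIV \<and> l1_norm h \<le> 1 \<and>
     (\<forall>\<omega>. M (cis \<omega>) = 1 - fourier_symbol h \<omega>)}"

text \<open>
  Vectors of dimension \<open>\<beta> - 1\<close> are functions on \<open>nat\<close> of which only the
  entries with index in \<open>{1..\<beta>-1}\<close> are used.
\<close>

definition grid_freq :: "nat \<Rightarrow> nat \<Rightarrow> real" where
  "grid_freq \<beta> r = real r / real \<beta> * pi"

definition v_minus :: "(complex \<Rightarrow> complex) \<Rightarrow> nat \<Rightarrow> nat \<Rightarrow> nat \<Rightarrow> real" where
  "v_minus G \<beta> i r =
     Re ((1 - cis (- (grid_freq \<beta> r * real i))) * G (cis (grid_freq \<beta> r)))"

definition v_plus :: "(complex \<Rightarrow> complex) \<Rightarrow> nat \<Rightarrow> nat \<Rightarrow> nat \<Rightarrow> real" where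
  "v_plus G \<beta> i r =
     Re ((1 + cis (- (grid_freq \<beta> r * real i))) * G (cis (grid_freq \<beta> r)))"

end

theory Submission
  imports Defs
begin

text \<open>
  Put \<open>c i = \<Sum>r. \<Lambda> r * Re (cis (- \<omega> r * i) * G (cis (\<omega> r)))\<close> and \<open>a = c 0\<close>. The hypotheses say that
  \<open>a \<le> c i\<close>, respectively \<open>a \<le> - \<bar>c i\<bar>\<close>, for \<open>0 \<le> i < 2 * \<beta>\<close>, and by periodicity for every integer \<open>i\<close>.
  As \<open>c\<close> has mean zero over a period, \<open>a \<le> 0\<close>. A multiplier with coefficients \<open>h\<close> then satisfies
  \<open>\<Sum>r. \<Lambda> r * Re (M G) = a - (\<Sum>i. h i * c i) \<le> a * (1 - \<parallel>h\<parallel>\<^sub>1) \<le> 0\<close>, so \<open>Re (M G)\<close> cannot be positive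
  at all grid frequencies.
\<close>

text \<open>This is the \<open>c\<close> of the overview. The index runs over \<open>int\<close>
  because multiplier coefficients are two-sided, although the vectors only supply indices below
  \<open>2 * \<beta>\<close>.\<close>

definition grid_moment :: "(complex \<Rightarrow> complex) \<Rightarrow> nat \<Rightarrow> (nat \<Rightarrow> real) \<Rightarrow> int \<Rightarrow> real" where
  "grid_moment G \<beta> \<Lambda> i =
     (\<Sum>r=1..\<beta>-1. \<Lambda> r * Re (cis (- (grid_freq \<beta> r * real_of_int i)) * G (cis (grid_freq \<beta> r))))"

lemma sum_v_minus:
  "(\<Sum>r=1..\<beta>-1. \<Lambda> r * v_minus G \<beta> i r) = grid_moment G \<beta> \<Lambda> 0 - grid_moment G \<beta> \<Lambda> (int i)"
  unfolding grid_moment_def v_minus_def sum_subtractf[symmetric]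
  by (intro sum.cong refl) (simp add: algebra_simps)

lemma sum_v_plus:
  "(\<Sum>r=1..\<beta>-1. \<Lambda> r * v_plus G \<beta> i r) = grid_moment G \<beta> \<Lambda> 0 + grid_moment G \<beta> \<Lambda> (int i)"
  unfolding grid_moment_def v_plus_def sum.distrib[symmetric]
  by (intro sum.cong refl) (simp add: algebra_simps)

text \<open>Raising \<open>i\<close> by \<open>2 * \<beta>\<close> turns the angle by
  \<open>2 * pi * r\<close>, a whole number of turns.\<close>

lemma cis_grid_mod:
  assumes "\<beta> > 0"
  shows "cis (- (grid_freq \<beta> r * real_of_int (i mod (2 * int \<beta>)))) = cis (- (grid_freq \<beta> r * real_of_int i))"
proof -
  define k m where "k = i div (2 * int \<beta>)" and "m = i mod (2 * int \<beta>)"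
  have "i = 2 * int \<beta> * k + m"
    by (simp add: k_def m_def)
  then have "- (grid_freq \<beta> r * real_of_int i) =
      - (grid_freq \<beta> r * real_of_int m) + 2 * pi * real_of_int (- int r * k)"
    using assms by (simp add: grid_freq_def field_simps)
  then show ?thesis
    by (simp only: m_def cis_mult[symmetric] cis_multiple_2pi[OF Ints_of_int] mult_1_right)
qed

lemma grid_moment_mod:
  assumes "\<beta> > 0"
  shows "grid_moment G \<beta> \<Lambda> (i mod (2 * int \<beta>)) = grid_moment G \<beta> \<Lambda> i"
  unfolding grid_moment_def by (simp only: cis_grid_mod[OF assms])

text \<open>A full geometric sum over the powers of a \<open>2 * \<beta>\<close>-th root of unity
  other than 1.\<close>

lemma sum_cis_grid_eq_0:
  assumes "r \<in> {1..\<beta>-1}"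
  shows "(\<Sum>i<2*\<beta>. cis (- (grid_freq \<beta> r * real i))) = 0"
proof -
  define x where "x = cis (- grid_freq \<beta> r)"
  have pow: "cis (- (grid_freq \<beta> r * real i)) = x ^ i" for i
    by (simp only: x_def Complex.DeMoivre mult.commute mult_minus_right)
  have r: "0 < r" "r < \<beta>" using assms by auto
  have "0 < grid_freq \<beta> r" "grid_freq \<beta> r < pi"
    using r by (auto simp: grid_freq_def field_simps)
  \<comment> \<open>Up to sign this is the imaginary part of \<open>x\<close>, so \<open>x\<close>
    is not real.\<close>
  then have "sin (grid_freq \<beta> r) \<noteq> 0"
    using sin_gt_zero by fastforce
  then have "x \<noteq> 1"
    by (auto simp: x_def complex_eq_iff)
  moreover have "x ^ (2 * \<beta>) = 1"
    using cis_grid_mod[of \<beta> r "2 * int \<beta>"] r unfolding pow[symmetric] by simp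
  ultimately show ?thesis
    by (simp add: pow geometric_sum)
qed

lemma sum_grid_moment_eq_0: "(\<Sum>i<2*\<beta>. grid_moment G \<beta> \<Lambda> (int i)) = 0"
proof -
  have "(\<Sum>i<2*\<beta>. grid_moment G \<beta> \<Lambda> (int i)) =
      (\<Sum>r=1..\<beta>-1. \<Lambda> r * Re ((\<Sum>i<2*\<beta>. cis (- (grid_freq \<beta> r * real i))) * G (cis (grid_freq \<beta> r))))"
    unfolding grid_moment_def
    by (subst sum.swap) (simp add: sum_distrib_left sum_distrib_right)
  also have "\<dots> = 0"
    by (intro sum.neutral ballI) (simp only: sum_cis_grid_eq_0, simp)
  finally show ?thesis .
qed

text \<open>Periodicity carries a bound from one period to all integers. The factor \<open>s\<close>
  is 1 for the bounds from \<open>v_minus\<close> and -1 for those from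
  \<open>v_plus\<close>.\<close>

lemma grid_moment_ge_moment_0:
  assumes "\<beta> > 0" and le: "\<forall>i\<in>{0..2*\<beta>-1}. grid_moment G \<beta> \<Lambda> 0 \<le> s * grid_moment G \<beta> \<Lambda> (int i)"
  shows "grid_moment G \<beta> \<Lambda> 0 \<le> s * grid_moment G \<beta> \<Lambda> i"
proof -
  define k where "k = nat (i mod (2 * int \<beta>))"
  have k: "int k = i mod (2 * int \<beta>)"
    using assms(1) by (simp add: k_def)
  have "i mod (2 * int \<beta>) < 2 * int \<beta>"
    using assms(1) by (intro pos_mod_bound) simp
  then have "k \<in> {0..2*\<beta>-1}" using k by auto
  then show ?thesis
    using le grid_moment_mod[OF assms(1), of G \<Lambda> i] k by metis
qed

text \<open>A minimum is at most the mean over a period, and that mean is 0.\<close>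

lemma grid_moment_0_nonpos:
  assumes "\<beta> > 0" and le: "\<And>i. grid_moment G \<beta> \<Lambda> 0 \<le> grid_moment G \<beta> \<Lambda> i"
  shows "grid_moment G \<beta> \<Lambda> 0 \<le> 0"
proof -
  have "(\<Sum>i<2*\<beta>. grid_moment G \<beta> \<Lambda> 0) \<le> (\<Sum>i<2*\<beta>. grid_moment G \<beta> \<Lambda> (int i))"
    by (intro sum_mono le)
  then show ?thesis
    using assms(1) by (simp add: sum_grid_moment_eq_0 mult_le_0_iff)
qed

lemma has_sum_sum:
  fixes f :: "'i \<Rightarrow> 'a \<Rightarrow> 'b :: topological_comm_monoid_add"
  assumes "\<And>r. r \<in> R \<Longrightarrow> (f r has_sum s r) A"
  shows "((\<lambda>x. \<Sum>r\<in>R. f r x) has_sum (\<Sum>r\<in>R. s r)) A"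
  \<comment> \<open>For infinite \<open>R\<close> both finite sums default to 0, leaving the zero
    family.\<close>
  using assms by (induction R rule: infinite_finite_induct) (auto intro!: has_sum_add has_sum_0)

lemma fourier_symbol_has_sum:
  assumes "(\<lambda>i. \<bar>h i\<bar>) summable_on UNIV"
  shows "((\<lambda>i. complex_of_real (h i) * cis (- (\<omega> * real_of_int i))) has_sum fourier_symbol h \<omega>) UNIV"
proof -
  have "(\<lambda>i. complex_of_real (h i) * cis (- (\<omega> * real_of_int i))) summable_on UNIV"
    \<comment> \<open>Each \<open>cis\<close> factor has modulus 1, so the terms have norm
      \<open>\<bar>h i\<bar>\<close>.\<close>
    by (rule abs_summable_summable) (use assms in \<open>simp add: norm_mult\<close>)
  then show ?thesis
    unfolding fourier_symbol_def by (rule has_sum_infsum)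
qed

text \<open>Exchanges the finite sum over frequencies with the series over \<open>i\<close>, so that
  termwise bounds on the moments become a bound on the symbol at the grid frequencies.\<close>

lemma grid_moment_has_sum:
  assumes "(\<lambda>i. \<bar>h i\<bar>) summable_on UNIV"
  shows "((\<lambda>i. h i * grid_moment G \<beta> \<Lambda> i) has_sum
    (\<Sum>r=1..\<beta>-1. \<Lambda> r * Re (fourier_symbol h (grid_freq \<beta> r) * G (cis (grid_freq \<beta> r))))) UNIV"
proof -
  have "((\<lambda>i. \<Sum>r=1..\<beta>-1. \<Lambda> r * Re (complex_of_real (h i) * cis (- (grid_freq \<beta> r * real_of_int i)) *
      G (cis (grid_freq \<beta> r)))) has_sum
    (\<Sum>r=1..\<beta>-1. \<Lambda> r * Re (fourier_symbol h (grid_freq \<beta> r) * G (cis (grid_freq \<beta> r))))) UNIV"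
    by (intro has_sum_sum has_sum_cmult_right has_sum_Re has_sum_cmult_left
        fourier_symbol_has_sum assms)
  moreover have "(\<Sum>r=1..\<beta>-1. \<Lambda> r * Re (complex_of_real (h i) * cis (- (grid_freq \<beta> r * real_of_int i)) *
      G (cis (grid_freq \<beta> r)))) = h i * grid_moment G \<beta> \<Lambda> i" for i
    unfolding grid_moment_def sum_distrib_left
    by (intro sum.cong refl) (simp add: algebra_simps)
  ultimately show ?thesis by simp
qed

text \<open>Serves both parts of the theorem: the absolute value in \<open>le\<close> lets one
  inequality cover nonnegative and signed coefficients. Positivity on the grid would make the
  weighted sum of \<open>Re (M G)\<close> positive, while \<open>le\<close> and
  \<open>nonpos\<close> make it at most 0.\<close>

lemma multiplier_not_positive_on_grid:
  assumes summable: "(\<lambda>i. \<bar>h i\<bar>) summable_on UNIV" and norm: "l1_norm h \<le> 1"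
    and M: "\<And>\<omega>. M (cis \<omega>) = 1 - fourier_symbol h \<omega>"
    and nonpos: "grid_moment G \<beta> \<Lambda> 0 \<le> 0"
    and le: "\<And>i. \<bar>h i\<bar> * grid_moment G \<beta> \<Lambda> 0 \<le> h i * grid_moment G \<beta> \<Lambda> i"
    and \<Lambda>: "\<exists>r\<in>{1..\<beta>-1}. \<Lambda> r \<noteq> 0" "\<forall>r\<in>{1..\<beta>-1}. \<Lambda> r \<ge> 0"
  shows "\<not> (\<forall>\<omega>\<in>{0..pi}. Re (M (cis \<omega>) * G (cis \<omega>)) > 0)"
proof
  assume pos: "\<forall>\<omega>\<in>{0..pi}. Re (M (cis \<omega>) * G (cis \<omega>)) > 0"
  let ?w = "grid_freq \<beta>" and ?a = "grid_moment G \<beta> \<Lambda> 0"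
  let ?S = "\<Sum>r=1..\<beta>-1. \<Lambda> r * Re (fourier_symbol h (?w r) * G (cis (?w r)))"
  have grid: "?w r \<in> {0..pi}" if "r \<in> {1..\<beta>-1}" for r
    using that by (auto simp: grid_freq_def field_simps)
  have "((\<lambda>i. \<bar>h i\<bar> * ?a) has_sum (l1_norm h * ?a)) UNIV"
    unfolding l1_norm_def by (intro has_sum_cmult_left has_sum_infsum summable)
  then have "l1_norm h * ?a \<le> ?S"
    using grid_moment_has_sum[OF summable] le by (rule has_sum_mono)
  \<comment> \<open>As \<open>?a\<close> is nonpositive, scaling it by a factor of at most 1 cannot
    lower it.\<close>
  moreover have "?a \<le> l1_norm h * ?a"
    using mult_right_mono_neg[OF norm nonpos] by simp
  \<comment> \<open>The constant 1 in the multiplier contributes \<open>?a\<close>, since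
    \<open>cis 0 = 1\<close>.\<close>
  moreover have "(\<Sum>r=1..\<beta>-1. \<Lambda> r * Re (M (cis (?w r)) * G (cis (?w r)))) = ?a - ?S"
    unfolding grid_moment_def M sum_subtractf[symmetric]
    by (intro sum.cong refl) (simp add: algebra_simps)
  moreover have "(\<Sum>r=1..\<beta>-1. \<Lambda> r * Re (M (cis (?w r)) * G (cis (?w r)))) > 0"
  proof -
    obtain r where r: "r \<in> {1..\<beta>-1}" "\<Lambda> r > 0"
      using \<Lambda> by fastforce
    show ?thesis
    proof (rule sum_pos2[OF _ r(1)])
      show "0 < \<Lambda> r * Re (M (cis (?w r)) * G (cis (?w r)))"
        using r pos grid by (intro mult_pos_pos) auto
      show "0 \<le> \<Lambda> s * Re (M (cis (?w s)) * G (cis (?w s)))" if "s \<in> {1..\<beta>-1}" for s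
        using that \<Lambda>(2) pos grid by (intro mult_nonneg_nonneg less_imp_le[of 0 "Re _"]) auto
    qed simp
  qed
  ultimately show False by linarith
qed

theorem proposition1:
  fixes G :: "complex \<Rightarrow> complex" and \<beta> :: nat
  assumes "G \<in> RH_inf" and "\<beta> \<ge> 2"
  shows "((\<exists>\<Lambda> :: nat \<Rightarrow> real.
            (\<exists>r\<in>{1..\<beta>-1}. \<Lambda> r \<noteq> 0) \<and> (\<forall>r\<in>{1..\<beta>-1}. \<Lambda> r \<ge> 0) \<and>
            (\<forall>i\<in>{0..2*\<beta>-1}. (\<Sum>r=1..\<beta>-1. \<Lambda> r * v_minus G \<beta> i r) \<le> 0))
          \<longrightarrow> \<not> (\<exists>M\<in>ZF. \<forall>\<omega>\<in>{0..pi}. Re (M (cis \<omega>) * G (cis \<omega>)) > 0))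
       \<and> ((\<exists>\<Lambda> :: nat \<Rightarrow> real.
            (\<exists>r\<in>{1..\<beta>-1}. \<Lambda> r \<noteq> 0) \<and> (\<forall>r\<in>{1..\<beta>-1}. \<Lambda> r \<ge> 0) \<and>
            (\<forall>i\<in>{0..2*\<beta>-1}. (\<Sum>r=1..\<beta>-1. \<Lambda> r * v_minus G \<beta> i r) \<le> 0 \<and>
                             (\<Sum>r=1..\<beta>-1. \<Lambda> r * v_plus G \<beta> i r) \<le> 0))
          \<longrightarrow> \<not> (\<exists>M\<in>ZF_odd. \<forall>\<omega>\<in>{0..pi}. Re (M (cis \<omega>) * G (cis \<omega>)) > 0))"
proof (intro conjI impI notI; elim exE bexE conjE)
  fix \<Lambda> :: "nat \<Rightarrow> real" and M r
  assume nz: "r \<in> {1..\<beta>-1}" "\<Lambda> r \<noteq> 0" and nonneg: "\<forall>r\<in>{1..\<beta>-1}. \<Lambda> r \<ge> 0"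
    and minus: "\<forall>i\<in>{0..2*\<beta>-1}. (\<Sum>r=1..\<beta>-1. \<Lambda> r * v_minus G \<beta> i r) \<le> 0"
    and "M \<in> ZF" and pos: "\<forall>\<omega>\<in>{0..pi}. Re (M (cis \<omega>) * G (cis \<omega>)) > 0"
  then obtain h where h: "\<And>i. 0 \<le> h i" "(\<lambda>i. \<bar>h i\<bar>) summable_on UNIV" "l1_norm h \<le> 1"
    "\<And>\<omega>. M (cis \<omega>) = 1 - fourier_symbol h \<omega>"
    unfolding ZF_def by blast
  have \<beta>: "\<beta> > 0" using assms(2) by simp
  have ge: "grid_moment G \<beta> \<Lambda> 0 \<le> grid_moment G \<beta> \<Lambda> i" for i
  proof -
    have "grid_moment G \<beta> \<Lambda> 0 \<le> 1 * grid_moment G \<beta> \<Lambda> (int k)" if "k \<in> {0..2*\<beta>-1}" for k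
      using minus[rule_format, OF that] unfolding sum_v_minus by linarith
    then show ?thesis
      using grid_moment_ge_moment_0[OF \<beta>, of G \<Lambda> 1 i] by auto
  qed
  have "\<not> (\<forall>\<omega>\<in>{0..pi}. Re (M (cis \<omega>) * G (cis \<omega>)) > 0)"
  proof (rule multiplier_not_positive_on_grid[OF h(2-4) grid_moment_0_nonpos[OF \<beta> ge] _ _ nonneg])
    \<comment> \<open>Here \<open>\<bar>h i\<bar> = h i\<close>, so \<open>ge\<close> multiplied by
      \<open>h i\<close> suffices.\<close>
    show "\<bar>h i\<bar> * grid_moment G \<beta> \<Lambda> 0 \<le> h i * grid_moment G \<beta> \<Lambda> i" for i
      using mult_left_mono[OF ge h(1)] h(1)[of i] by simp
  qed (use nz in blast)
  then show False using pos by blast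
next
  fix \<Lambda> :: "nat \<Rightarrow> real" and M r
  assume nz: "r \<in> {1..\<beta>-1}" "\<Lambda> r \<noteq> 0" and nonneg: "\<forall>r\<in>{1..\<beta>-1}. \<Lambda> r \<ge> 0"
    and both: "\<forall>i\<in>{0..2*\<beta>-1}. (\<Sum>r=1..\<beta>-1. \<Lambda> r * v_minus G \<beta> i r) \<le> 0 \<and>
                             (\<Sum>r=1..\<beta>-1. \<Lambda> r * v_plus G \<beta> i r) \<le> 0"
    and "M \<in> ZF_odd" and pos: "\<forall>\<omega>\<in>{0..pi}. Re (M (cis \<omega>) * G (cis \<omega>)) > 0"
  then obtain h where h: "(\<lambda>i. \<bar>h i\<bar>) summable_on UNIV" "l1_norm h \<le> 1"
    "\<And>\<omega>. M (cis \<omega>) = 1 - fourier_symbol h \<omega>"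
    unfolding ZF_odd_def by blast
  have \<beta>: "\<beta> > 0" using assms(2) by simp
  have ge: "grid_moment G \<beta> \<Lambda> 0 \<le> grid_moment G \<beta> \<Lambda> i" for i
  proof -
    have "grid_moment G \<beta> \<Lambda> 0 \<le> 1 * grid_moment G \<beta> \<Lambda> (int k)" if "k \<in> {0..2*\<beta>-1}" for k
      using both[rule_format, OF that, THEN conjunct1] unfolding sum_v_minus by linarith
    then show ?thesis
      using grid_moment_ge_moment_0[OF \<beta>, of G \<Lambda> 1 i] by auto
  qed
  \<comment> \<open>The \<open>v_plus\<close> conditions also bound the moments from above by
    \<open>- grid_moment G \<beta> \<Lambda> 0\<close>, as coefficients of negative sign
    require.\<close>
  have ge': "grid_moment G \<beta> \<Lambda> 0 \<le> - grid_moment G \<beta> \<Lambda> i" for i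
  proof -
    have "grid_moment G \<beta> \<Lambda> 0 \<le> (-1) * grid_moment G \<beta> \<Lambda> (int k)" if "k \<in> {0..2*\<beta>-1}" for k
      using both[rule_format, OF that] unfolding sum_v_plus by linarith
    then show ?thesis
      using grid_moment_ge_moment_0[OF \<beta>, of G \<Lambda> "-1" i] by auto
  qed
  have "\<not> (\<forall>\<omega>\<in>{0..pi}. Re (M (cis \<omega>) * G (cis \<omega>)) > 0)"
  proof (rule multiplier_not_positive_on_grid[OF h grid_moment_0_nonpos[OF \<beta> ge] _ _ nonneg])
    \<comment> \<open>\<open>ge\<close> settles \<open>h i \<ge> 0\<close>; for negative
      \<open>h i\<close>, the right side is \<open>\<bar>h i\<bar>\<close> times the negated moment,
      which \<open>ge'\<close> bounds.\<close>
    show "\<bar>h i\<bar> * grid_moment G \<beta> \<Lambda> 0 \<le> h i * grid_moment G \<beta> \<Lambda> i" for i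
      using mult_left_mono[OF ge[of i], of "\<bar>h i\<bar>"] mult_left_mono[OF ge'[of i], of "\<bar>h i\<bar>"]
      by (cases "h i \<ge> 0") auto
  qed (use nz in blast)
  then show False using pos by blast
qed

end
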